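(* Let $\alpha\in\mathbb R$. For $A\in[0,\infty]$, the inequality \[ \sup_{n\ge1}\Big|\frac1n\sum_{k=1}^nx_k\Big|n^\alpha\le A\sup_{k\ge1}|x_k|k^\alpha \] holds for all real sequences $x$ if and only if it holds for all nonnegative sequences $x$, if and only if it holds for all nonnegative, nonincreasing sequences $x$. The best (least) constant $A\in[0,\infty]$ for these is \[ A=\begin{cases} 1,&\alpha<0;\\ \dfrac1{1-\alpha},&0\le\alpha<1;\\ \infty,&\alpha\ge1.\end{cases} \] The inequality holds for all nonnegative, nondecreasing sequences $x$ with best (least) constant \[ A=\begin{cases}1,&\alpha\le0;\\0,&\alpha>0.\end{cases} \]
   Context: Sequences are indexed by the positive integers; suprema take values in $[0,\infty]$. Conventions: $\infty\cdot0=0$ when $A=\infty$ and the supremum on the right is $0$; the inequality is regarded as holding whenever the supremum on the right-hand side is $\infty$ (even if $A=0$). *)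

theory Defs
  imports Complex_Main "HOL-Library.Extended_Nonnegative_Real"
begin

text \<open>
  Sequences indexed by the positive integers are functions on \<open>nat\<close> of which only the values
  at positive arguments matter; the value at \<open>0\<close> is never constrained or used.
\<close>

definition weighted_sup :: "real \<Rightarrow> (nat \<Rightarrow> real) \<Rightarrow> ennreal" where
  "weighted_sup \<alpha> x = (SUP k\<in>{1..}. ennreal (\<bar>x k\<bar> * real k powr \<alpha>))"

definition average :: "(nat \<Rightarrow> real) \<Rightarrow> nat \<Rightarrow> real" where
  "average x n = (1 / real n) * (\<Sum>k=1..n. x k)"

text \<open>
  The inequality is regarded as holding whenever the supremum on the right is infinite. The
  disjunct is needed because \<open>0 * \<infinity> = 0\<close> in \<^typ>\<open>ennreal\<close>; the convention \<open>\<infinity> * 0 = 0\<close>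
  is that of \<^typ>\<open>ennreal\<close>.
\<close>

definition averaging_ineq :: "real \<Rightarrow> ennreal \<Rightarrow> (nat \<Rightarrow> real) \<Rightarrow> bool" where
  "averaging_ineq \<alpha> A x \<longleftrightarrow>
     weighted_sup \<alpha> x = \<infinity> \<or> weighted_sup \<alpha> (average x) \<le> A * weighted_sup \<alpha> x"

definition nonneg_seqs :: "(nat \<Rightarrow> real) set" where
  "nonneg_seqs = {x. \<forall>k\<ge>1. 0 \<le> x k}"

definition nonincreasing_seqs :: "(nat \<Rightarrow> real) set" where
  "nonincreasing_seqs = {x. antimono_on {1..} x}"

definition nondecreasing_seqs :: "(nat \<Rightarrow> real) set" where
  "nondecreasing_seqs = {x. mono_on {1..} x}"

definition holds_on :: "real \<Rightarrow> ennreal \<Rightarrow> (nat \<Rightarrow> real) set \<Rightarrow> bool" where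
  "holds_on \<alpha> A X \<longleftrightarrow> (\<forall>x\<in>X. averaging_ineq \<alpha> A x)"

definition best_constant :: "real \<Rightarrow> (nat \<Rightarrow> real) set \<Rightarrow> ennreal \<Rightarrow> bool" where
  "best_constant \<alpha> X A \<longleftrightarrow> holds_on \<alpha> A X \<and> (\<forall>B. holds_on \<alpha> B X \<longrightarrow> A \<le> B)"

end

theory Submission
  imports Defs
begin

text \<open>
  If \<open>\<bar>x k\<bar> * k powr \<alpha> \<le> M\<close> for all \<open>k \<ge> 1\<close>, then by the triangle inequality the weighted average
  at \<open>n\<close> is at most \<open>M\<close> times the same quantity for the power sequence \<open>k powr - \<alpha>\<close>, namely
  \<open>n powr (\<alpha> - 1) * (\<Sum>k=1..n. k powr - \<alpha>)\<close>. So power sequences are extremal, and the upper bounds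
  are bounds on power sums. For \<open>\<alpha> \<le> 0\<close> every summand is at most \<open>n powr - \<alpha>\<close>, which gives the
  constant \<open>1\<close>. For \<open>0 \<le> \<alpha> < 1\<close> the sum is compared with \<open>n powr (1 - \<alpha>) / (1 - \<alpha>)\<close> by
  telescoping; the increments of \<open>k powr (1 - \<alpha>)\<close> are controlled from both sides by the tangent
  line of that concave function (\<open>powr_le_tangent\<close>).

  For the lower bounds it suffices to test nonnegative nonincreasing sequences, the smallest of the
  first three classes: the unit sequence \<open>1, 0, 0, \<dots>\<close> forces \<open>A \<ge> 1\<close>, and for \<open>\<alpha> \<ge> 0\<close> the
  sequence \<open>k powr - \<alpha>\<close> is itself nonincreasing. Its weighted average
  \<open>(1 / n) * (\<Sum>k=1..n. (n / k) powr \<alpha>)\<close> increases with \<open>\<alpha>\<close>, so it may be bounded below through any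
  exponent \<open>\<beta> \<le> \<alpha>\<close> with \<open>0 \<le> \<beta> < 1\<close>, and there the telescoping shows that it eventually exceeds
  every number below \<open>1 / (1 - \<beta>)\<close>. The choice \<open>\<beta> = \<alpha>\<close> settles \<open>0 \<le> \<alpha> < 1\<close>; letting \<open>\<beta>\<close> tend to
  \<open>1\<close> settles \<open>\<alpha> \<ge> 1\<close> without a separate treatment of the harmonic series. Since all three classes
  have the same best constant, and the inequality is monotone in \<open>A\<close>, the stated equivalences
  follow.

  For nonnegative nondecreasing sequences and \<open>\<alpha> \<le> 0\<close> the constant \<open>1\<close> works because it works for
  all sequences, and the constant sequence \<open>1\<close> shows that it is best. If \<open>\<alpha> > 0\<close>, a nonzero sequence
  of this kind has infinite supremum on the right, so that \<open>A = 0\<close> works.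
\<close>

section \<open>Weighted suprema and monotonicity in the constant\<close>

lemma weighted_sup_leI:
  assumes "\<And>k. 1 \<le> k \<Longrightarrow> ennreal (\<bar>x k\<bar> * real k powr \<alpha>) \<le> c"
  shows "weighted_sup \<alpha> x \<le> c"
  unfolding weighted_sup_def by (rule SUP_least) (use assms in auto)

lemma weighted_sup_upper:
  "1 \<le> k \<Longrightarrow> ennreal (\<bar>x k\<bar> * real k powr \<alpha>) \<le> weighted_sup \<alpha> x"
  unfolding weighted_sup_def by (rule SUP_upper) auto

lemma weighted_sup_finiteE:
  assumes "weighted_sup \<alpha> x \<noteq> \<infinity>"
  obtains M where "0 \<le> M" "weighted_sup \<alpha> x = ennreal M"
    "\<And>k. 1 \<le> k \<Longrightarrow> \<bar>x k\<bar> * real k powr \<alpha> \<le> M"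
proof -
  obtain M where M: "0 \<le> M" "weighted_sup \<alpha> x = ennreal M"
    using assms by (cases "weighted_sup \<alpha> x") auto
  have "\<bar>x k\<bar> * real k powr \<alpha> \<le> M" if "1 \<le> k" for k
    using weighted_sup_upper[OF that, of x \<alpha>] M by simp
  with M that show thesis by blast
qed

lemma weighted_sup_eq_0:
  assumes "\<And>k. 1 \<le> k \<Longrightarrow> x k = 0"
  shows "weighted_sup \<alpha> x = 0"
  using weighted_sup_leI[of x \<alpha> 0] assms by simp

lemma average_eq_0:
  assumes "\<And>k. 1 \<le> k \<Longrightarrow> x k = 0"
  shows "average x n = 0"
  using assms by (simp add: average_def)

lemma holds_on_mono:
  assumes "holds_on \<alpha> A X" "A \<le> B"
  shows "holds_on \<alpha> B X"
  using assms unfolding holds_on_def averaging_ineq_def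
  by (meson mult_right_mono order_trans zero_le)

lemma holds_on_subset: "holds_on \<alpha> A X \<Longrightarrow> Y \<subseteq> X \<Longrightarrow> holds_on \<alpha> A Y"
  unfolding holds_on_def by blast

lemma best_constant_iff_le: "best_constant \<alpha> X C \<Longrightarrow> holds_on \<alpha> B X \<longleftrightarrow> C \<le> B"
  unfolding best_constant_def using holds_on_mono by blast

lemma best_constant_between:
  assumes "holds_on \<alpha> C X" "\<And>B. holds_on \<alpha> B Y \<Longrightarrow> C \<le> B" "Y \<subseteq> Z" "Z \<subseteq> X"
  shows "best_constant \<alpha> Z C"
  using assms holds_on_subset unfolding best_constant_def by blast

section \<open>Power sums\<close>

text \<open>
  This is concavity of \<open>u powr p\<close>, derived from \<open>1 + y \<le> exp y\<close>. That inequality, at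
  \<open>y = (1 - p) * ln u\<close> and at \<open>y = - p * ln u\<close>, gives the tangent line of the exponential function at
  \<open>p * ln u\<close> evaluated at \<open>ln u\<close> and at \<open>0\<close>; in the combination with weights \<open>p\<close> and \<open>1 - p\<close> the
  logarithms cancel.
\<close>
lemma powr_le_affine:
  fixes u p :: real
  assumes "0 < u" "0 \<le> p" "p \<le> 1"
  shows "u powr p \<le> 1 + p * (u - 1)"
proof -
  define e where "e = u powr p"
  have e: "0 < e" using assms by (simp add: e_def)
  have "e * (1 + (1 - p) * ln u) \<le> e * exp ((1 - p) * ln u)"
    using e by (intro mult_left_mono exp_ge_add_one_self) auto
  also have "\<dots> = u"
    using assms by (simp add: e_def powr_def mult_exp_exp algebra_simps)
  finally have 1: "e * (1 + (1 - p) * ln u) \<le> u" .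
  have "e * (1 + - p * ln u) \<le> e * exp (- p * ln u)"
    using e by (intro mult_left_mono exp_ge_add_one_self) auto
  also have "\<dots> = 1"
    using assms by (simp add: e_def powr_def mult_exp_exp)
  finally have 2: "e * (1 + - p * ln u) \<le> 1" .
  have "p * (e * (1 + (1 - p) * ln u)) + (1 - p) * (e * (1 + - p * ln u)) \<le> p * u + (1 - p) * 1"
    using 1 2 assms by (intro add_mono mult_left_mono) auto
  then show ?thesis by (simp add: e_def algebra_simps)
qed

lemma powr_le_tangent:
  fixes s t p :: real
  assumes "0 \<le> s" "0 < t" "0 \<le> p" "p \<le> 1"
  shows "s powr p \<le> t powr p + p * t powr (p - 1) * (s - t)"
proof (cases "s = 0")
  case True
  have "t powr (p - 1) * t = t powr p"
    using assms by (simp add: powr_diff)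
  then have "t powr p + p * t powr (p - 1) * (s - t) = (1 - p) * t powr p"
    using True by (simp add: algebra_simps)
  then show ?thesis using True assms by simp
next
  case False
  then have "(s / t) powr p \<le> 1 + p * (s / t - 1)"
    using assms by (intro powr_le_affine) auto
  then have "t powr p * (s / t) powr p \<le> t powr p * (1 + p * (s / t - 1))"
    by (intro mult_left_mono) auto
  moreover have "t powr p * (s / t) powr p = s powr p"
    using assms by (simp add: powr_divide)
  moreover have "t powr p * (1 + p * (s / t - 1)) = t powr p + p * t powr (p - 1) * (s - t)"
    using assms by (simp add: powr_diff field_simps)
  ultimately show ?thesis by simp
qed

lemma sum_powr_le:
  assumes "0 \<le> \<beta>" "\<beta> < 1"
  shows "(\<Sum>k=1..n. real k powr - \<beta>) \<le> real n powr (1 - \<beta>) / (1 - \<beta>)"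
proof (induction n)
  case (Suc n)
  have "real n powr (1 - \<beta>) + (1 - \<beta>) * real (Suc n) powr - \<beta> \<le> real (Suc n) powr (1 - \<beta>)"
    using powr_le_tangent[of "real n" "real (Suc n)" "1 - \<beta>"] assms by simp
  then have "(real n powr (1 - \<beta>) + (1 - \<beta>) * real (Suc n) powr - \<beta>) / (1 - \<beta>)
      \<le> real (Suc n) powr (1 - \<beta>) / (1 - \<beta>)"
    using assms by (intro divide_right_mono) auto
  then have "real n powr (1 - \<beta>) / (1 - \<beta>) + real (Suc n) powr - \<beta>
      \<le> real (Suc n) powr (1 - \<beta>) / (1 - \<beta>)"
    using assms by (simp add: add_divide_distrib del: of_nat_Suc)
  then show ?case using Suc.IH by (simp del: of_nat_Suc)
qed simp

lemma sum_powr_ge: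
  assumes "0 \<le> \<beta>" "\<beta> < 1"
  shows "(real (n + 1) powr (1 - \<beta>) - 1) / (1 - \<beta>) \<le> (\<Sum>k=1..n. real k powr - \<beta>)"
proof (induction n)
  case (Suc n)
  have "real (Suc n + 1) powr (1 - \<beta>)
      \<le> real (Suc n) powr (1 - \<beta>) + (1 - \<beta>) * real (Suc n) powr - \<beta>"
    using powr_le_tangent[of "real (Suc n + 1)" "real (Suc n)" "1 - \<beta>"] assms by simp
  then have "(real (Suc n + 1) powr (1 - \<beta>) - 1) / (1 - \<beta>)
      \<le> ((real (Suc n) powr (1 - \<beta>) - 1) + (1 - \<beta>) * real (Suc n) powr - \<beta>) / (1 - \<beta>)"
    using assms by (intro divide_right_mono) auto
  then have "(real (Suc n + 1) powr (1 - \<beta>) - 1) / (1 - \<beta>)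
      \<le> (real (n + 1) powr (1 - \<beta>) - 1) / (1 - \<beta>) + real (Suc n) powr - \<beta>"
    using assms by (simp add: add_divide_distrib[where b = "(1 - \<beta>) * _"] del: of_nat_Suc)
  then show ?case using Suc.IH by (simp del: of_nat_Suc)
qed simp

section \<open>Upper bounds\<close>

text \<open>
  The hypothesis is the inequality itself for the sequence \<open>k powr - \<alpha>\<close>, which dominates every
  sequence up to the factor \<open>weighted_sup \<alpha> x\<close>.
\<close>
lemma averaging_ineq_if_sum_powr_le:
  assumes "0 \<le> c"
    and sum_le: "\<And>n. 1 \<le> n \<Longrightarrow> (\<Sum>k=1..n. real k powr - \<alpha>) \<le> c * real n powr (1 - \<alpha>)"
  shows "averaging_ineq \<alpha> (ennreal c) x"
proof (cases "weighted_sup \<alpha> x = \<infinity>")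
  case False
  then obtain M where M: "0 \<le> M" "weighted_sup \<alpha> x = ennreal M"
    and le_M: "\<And>k. 1 \<le> k \<Longrightarrow> \<bar>x k\<bar> * real k powr \<alpha> \<le> M"
    by (rule weighted_sup_finiteE) blast
  have "\<bar>average x n\<bar> * real n powr \<alpha> \<le> c * M" if n: "1 \<le> n" for n
  proof -
    have "\<bar>\<Sum>k=1..n. x k\<bar> \<le> (\<Sum>k=1..n. \<bar>x k\<bar>)"
      by (rule sum_abs)
    also have "\<dots> \<le> (\<Sum>k=1..n. M * real k powr - \<alpha>)"
    proof (rule sum_mono)
      fix k assume "k \<in> {1..n}"
      then show "\<bar>x k\<bar> \<le> M * real k powr - \<alpha>"
        using le_M[of k] by (simp add: powr_minus field_simps)
    qed
    also have "\<dots> \<le> M * (c * real n powr (1 - \<alpha>))"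
      using sum_le[OF n] M by (simp add: sum_distrib_left[symmetric] mult_left_mono)
    finally have "\<bar>\<Sum>k=1..n. x k\<bar> \<le> M * (c * real n powr (1 - \<alpha>))" .
    then have "\<bar>\<Sum>k=1..n. x k\<bar> * (real n powr \<alpha> / real n)
        \<le> M * (c * real n powr (1 - \<alpha>)) * (real n powr \<alpha> / real n)"
      by (rule mult_right_mono) simp
    also have "\<dots> = c * M"
      using n by (simp add: powr_diff)
    finally show ?thesis
      by (simp add: average_def abs_mult)
  qed
  then have "weighted_sup \<alpha> (average x) \<le> ennreal (c * M)"
    by (intro weighted_sup_leI ennreal_leI)
  then show ?thesis
    using M assms by (simp add: averaging_ineq_def ennreal_mult)
qed (simp add: averaging_ineq_def)

lemma averaging_ineq_one:
  assumes "\<alpha> \<le> 0"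
  shows "averaging_ineq \<alpha> 1 x"
proof -
  have "(\<Sum>k=1..n. real k powr - \<alpha>) \<le> 1 * real n powr (1 - \<alpha>)" if "1 \<le> n" for n
  proof -
    have "(\<Sum>k=1..n. real k powr - \<alpha>) \<le> (\<Sum>k=1..n. real n powr - \<alpha>)"
      using assms by (intro sum_mono powr_mono2) auto
    also have "\<dots> = real n powr (1 - \<alpha>)"
      using that by (simp add: powr_diff powr_minus divide_inverse)
    finally show ?thesis by simp
  qed
  then show ?thesis
    using averaging_ineq_if_sum_powr_le[of 1 \<alpha> x] by simp
qed

lemma averaging_ineq_lt_one:
  assumes "0 \<le> \<alpha>" "\<alpha> < 1"
  shows "averaging_ineq \<alpha> (ennreal (1 / (1 - \<alpha>))) x"
  using assms sum_powr_le[OF assms] by (intro averaging_ineq_if_sum_powr_le) auto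

text \<open>
  Because \<open>\<infinity> * 0 = 0\<close>, the constant \<open>\<infinity>\<close> still makes a claim about sequences that vanish at all
  positive arguments; their averages vanish as well.
\<close>
lemma averaging_ineq_infinity: "averaging_ineq \<alpha> \<infinity> x"
proof (cases "weighted_sup \<alpha> x = 0")
  case True
  have "x k = 0" if "1 \<le> k" for k
    using weighted_sup_upper[OF that, of x \<alpha>] that True by (simp add: ennreal_eq_0_iff mult_le_0_iff)
  then have "weighted_sup \<alpha> (average x) = 0"
    by (intro weighted_sup_eq_0 average_eq_0)
  then show ?thesis by (simp add: averaging_ineq_def)
next
  case False
  then show ?thesis by (simp add: averaging_ineq_def ennreal_top_mult)
qed

section \<open>Lower bounds\<close>

text \<open>
  Applied to sequences with \<open>weighted_sup \<alpha> x = 1\<close>, on which the inequality reads off \<open>B\<close> as an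
  upper bound for each weighted average.
\<close>
lemma weighted_average_le_constant:
  assumes "averaging_ineq \<alpha> B x" "weighted_sup \<alpha> x = 1" "1 \<le> n"
  shows "ennreal (\<bar>average x n\<bar> * real n powr \<alpha>) \<le> B"
  using assms weighted_sup_upper[of n "average x" \<alpha>]
  by (auto simp: averaging_ineq_def intro: order_trans)

lemma constant_ge_one:
  assumes "averaging_ineq \<alpha> B x" "weighted_sup \<alpha> x = 1" "x 1 = 1"
  shows "1 \<le> B"
  using weighted_average_le_constant[of \<alpha> B x 1] assms by (simp add: average_def)

lemma nonincreasing_constant_ge_one:
  assumes "holds_on \<alpha> B (nonneg_seqs \<inter> nonincreasing_seqs)"
  shows "1 \<le> B"
proof (rule constant_ge_one)
  define x :: "nat \<Rightarrow> real" where "x k = (if k \<le> 1 then 1 else 0)" for k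
  have "x \<in> nonneg_seqs \<inter> nonincreasing_seqs"
    by (auto simp: x_def nonneg_seqs_def nonincreasing_seqs_def monotone_on_def)
  then show "averaging_ineq \<alpha> B x"
    using assms by (simp add: holds_on_def)
  show "weighted_sup \<alpha> x = 1"
  proof (rule antisym)
    show "weighted_sup \<alpha> x \<le> 1"
      by (rule weighted_sup_leI) (auto simp: x_def)
    show "1 \<le> weighted_sup \<alpha> x"
      using weighted_sup_upper[of 1 x \<alpha>] by (simp add: x_def)
  qed
  show "x 1 = 1" by (simp add: x_def)
qed

lemma weighted_sup_powr_minus: "weighted_sup \<alpha> (\<lambda>k. real k powr - \<alpha>) = 1"
proof -
  have "weighted_sup \<alpha> (\<lambda>k. real k powr - \<alpha>) = (SUP k\<in>{1::nat..}. 1)"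
    unfolding weighted_sup_def by (intro SUP_cong) (auto simp: powr_minus)
  then show ?thesis by simp
qed

text \<open>
  The comparison with a smaller exponent holds because
  \<open>n powr \<alpha> * k powr - \<alpha> = (n / k) powr \<alpha>\<close> with base at least \<open>1\<close>.
\<close>
lemma weighted_average_powr_ge:
  assumes "0 \<le> \<beta>" "\<beta> < 1" "\<beta> \<le> \<alpha>" "1 \<le> n"
  shows "(1 - real n powr (\<beta> - 1)) / (1 - \<beta>)
    \<le> \<bar>average (\<lambda>k. real k powr - \<alpha>) n\<bar> * real n powr \<alpha>"
proof -
  have scale: "real n powr \<gamma> / real n * (\<Sum>k=1..n. real k powr - \<gamma>)
      = 1 / real n * (\<Sum>k=1..n. (real n / real k) powr \<gamma>)" for \<gamma>
    by (simp add: sum_distrib_left powr_divide powr_minus field_simps)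
  have "1 - real n powr (\<beta> - 1) = real n powr \<beta> / real n * (real n powr (1 - \<beta>) - 1)"
    using assms by (simp add: powr_diff field_simps)
  also have "\<dots> \<le> real n powr \<beta> / real n * (real (n + 1) powr (1 - \<beta>) - 1)"
    using assms by (intro mult_left_mono diff_right_mono powr_mono2) auto
  finally have "(1 - real n powr (\<beta> - 1)) / (1 - \<beta>)
      \<le> real n powr \<beta> / real n * (real (n + 1) powr (1 - \<beta>) - 1) / (1 - \<beta>)"
    using assms by (intro divide_right_mono) auto
  also have "\<dots> \<le> real n powr \<beta> / real n * (\<Sum>k=1..n. real k powr - \<beta>)"
    using mult_left_mono[OF sum_powr_ge[OF assms(1,2), of n], of "real n powr \<beta> / real n"] by simp
  also have "\<dots> = 1 / real n * (\<Sum>k=1..n. (real n / real k) powr \<beta>)"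
    by (rule scale)
  also have "\<dots> \<le> 1 / real n * (\<Sum>k=1..n. (real n / real k) powr \<alpha>)"
    using assms by (intro mult_left_mono sum_mono powr_mono) auto
  also have "\<dots> = real n powr \<alpha> / real n * (\<Sum>k=1..n. real k powr - \<alpha>)"
    by (rule scale[symmetric])
  also have "\<dots> = \<bar>average (\<lambda>k. real k powr - \<alpha>) n\<bar> * real n powr \<alpha>"
    by (simp add: average_def abs_mult sum_nonneg)
  finally show ?thesis .
qed

lemma nonincreasing_constant_ge:
  assumes holds: "holds_on \<alpha> B (nonneg_seqs \<inter> nonincreasing_seqs)"
    and \<beta>: "0 \<le> \<beta>" "\<beta> < 1" "\<beta> \<le> \<alpha>"
  shows "ennreal (1 / (1 - \<beta>)) \<le> B"
proof -
  define x where "x k = real k powr - \<alpha>" for k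
  have "x \<in> nonneg_seqs \<inter> nonincreasing_seqs"
    using \<beta> by (auto simp: x_def nonneg_seqs_def nonincreasing_seqs_def monotone_on_def powr_mono2')
  then have ineq: "averaging_ineq \<alpha> B x"
    using holds by (simp add: holds_on_def)
  have "ennreal ((1 - real n powr (\<beta> - 1)) / (1 - \<beta>)) \<le> B" if "1 \<le> n" for n
    using order_trans[OF ennreal_leI[OF weighted_average_powr_ge[OF \<beta> that]]]
      weighted_average_le_constant[OF ineq _ that] weighted_sup_powr_minus[of \<alpha>]
    by (simp add: x_def[abs_def])
  moreover have "(\<lambda>n. real n powr (\<beta> - 1)) \<longlonglongrightarrow> 0"
    using \<beta> by (intro tendsto_neg_powr filterlim_real_sequentially) auto
  then have "(\<lambda>n. ennreal ((1 - real n powr (\<beta> - 1)) / (1 - \<beta>))) \<longlonglongrightarrow> ennreal ((1 - 0) / (1 - \<beta>))"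
    using \<beta> by (intro tendsto_ennrealI tendsto_intros) auto
  ultimately show ?thesis
    by (intro LIMSEQ_le_const2[where X = "\<lambda>n. ennreal ((1 - real n powr (\<beta> - 1)) / (1 - \<beta>))"]) auto
qed

lemma nonincreasing_constant_eq_infinity:
  assumes holds: "holds_on \<alpha> B (nonneg_seqs \<inter> nonincreasing_seqs)" and "1 \<le> \<alpha>"
  shows "B = \<infinity>"
proof (rule ccontr)
  assume "B \<noteq> \<infinity>"
  then obtain b where b: "0 \<le> b" "B = ennreal b" by (cases B) auto
  \<comment> \<open>This exponent makes \<open>1 / (1 - \<beta>)\<close> equal to \<open>b + 1\<close>.\<close>
  define \<beta> where "\<beta> = 1 - 1 / (b + 1)"
  have "0 \<le> \<beta>" "\<beta> < 1"
    using b by (auto simp: \<beta>_def)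
  then have "ennreal (1 / (1 - \<beta>)) \<le> B"
    using \<open>1 \<le> \<alpha>\<close> by (intro nonincreasing_constant_ge[OF holds]) auto
  then show False using b by (simp add: \<beta>_def)
qed

section \<open>Nondecreasing sequences\<close>

lemma nondecreasing_constant_ge_one:
  assumes "holds_on \<alpha> B (nonneg_seqs \<inter> nondecreasing_seqs)" "\<alpha> \<le> 0"
  shows "1 \<le> B"
proof (rule constant_ge_one)
  have "(\<lambda>_. 1) \<in> nonneg_seqs \<inter> nondecreasing_seqs"
    by (auto simp: nonneg_seqs_def nondecreasing_seqs_def monotone_on_def)
  then show "averaging_ineq \<alpha> B (\<lambda>_. 1)"
    using assms by (simp add: holds_on_def)
  show "weighted_sup \<alpha> (\<lambda>_. 1) = 1"
  proof (rule antisym)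
    have "real k powr \<alpha> \<le> 1" if "1 \<le> k" for k
      using powr_mono[of \<alpha> 0 "real k"] that assms by simp
    then show "weighted_sup \<alpha> (\<lambda>_. 1) \<le> 1"
      by (intro weighted_sup_leI) simp
    show "1 \<le> weighted_sup \<alpha> (\<lambda>_. 1)"
      using weighted_sup_upper[of 1 "\<lambda>_. 1" \<alpha>] by simp
  qed
qed simp

text \<open>
  A finite supremum \<open>M\<close> gives \<open>x k \<le> x n \<le> M * n powr - \<alpha>\<close> for all \<open>n \<ge> k\<close>, and the right-hand side
  tends to \<open>0\<close>; only the zero sequence has a finite supremum.
\<close>
lemma averaging_ineq_zero_nondecreasing:
  assumes x: "x \<in> nonneg_seqs \<inter> nondecreasing_seqs" and "0 < \<alpha>"
  shows "averaging_ineq \<alpha> 0 x"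
proof (cases "weighted_sup \<alpha> x = \<infinity>")
  case False
  then obtain M where le_M: "\<And>k. 1 \<le> k \<Longrightarrow> \<bar>x k\<bar> * real k powr \<alpha> \<le> M"
    by (rule weighted_sup_finiteE) blast
  have "x k = 0" if k: "1 \<le> k" for k
  proof (rule antisym)
    have "x k \<le> M * real n powr - \<alpha>" if "k \<le> n" for n
    proof -
      have "x k \<le> x n"
        using x k that by (auto simp: nondecreasing_seqs_def monotone_on_def)
      also have "\<dots> \<le> \<bar>x n\<bar>" by simp
      also have "\<dots> \<le> M * real n powr - \<alpha>"
        using le_M[of n] k that by (simp add: powr_minus field_simps)
      finally show ?thesis .
    qed
    moreover have "(\<lambda>n. M * real n powr - \<alpha>) \<longlonglongrightarrow> M * 0"
      using \<open>0 < \<alpha>\<close>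
      by (intro tendsto_mult_left tendsto_neg_powr filterlim_real_sequentially) auto
    ultimately show "x k \<le> 0"
      using LIMSEQ_le_const[of "\<lambda>n. M * real n powr - \<alpha>" "M * 0" "x k"] by auto
    show "0 \<le> x k" using x k by (auto simp: nonneg_seqs_def)
  qed
  then have "weighted_sup \<alpha> (average x) = 0"
    by (intro weighted_sup_eq_0 average_eq_0)
  then show ?thesis by (simp add: averaging_ineq_def)
qed (simp add: averaging_ineq_def)

section \<open>The best constants\<close>

theorem theorem3p5:
  fixes \<alpha> :: real
  defines "C \<equiv> (if \<alpha> < 0 then 1 else if \<alpha> < 1 then ennreal (1 / (1 - \<alpha>)) else \<infinity>)"
  shows
    "(\<forall>A. (holds_on \<alpha> A UNIV \<longleftrightarrow> holds_on \<alpha> A nonneg_seqs) \<and>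
          (holds_on \<alpha> A nonneg_seqs \<longleftrightarrow> holds_on \<alpha> A (nonneg_seqs \<inter> nonincreasing_seqs))) \<and>
     best_constant \<alpha> UNIV C \<and>
     best_constant \<alpha> nonneg_seqs C \<and>
     best_constant \<alpha> (nonneg_seqs \<inter> nonincreasing_seqs) C \<and>
     best_constant \<alpha> (nonneg_seqs \<inter> nondecreasing_seqs) (if \<alpha> \<le> 0 then 1 else 0)"
proof -
  have upper: "holds_on \<alpha> C UNIV"
    using averaging_ineq_one averaging_ineq_lt_one averaging_ineq_infinity
    by (auto simp: holds_on_def C_def)
  have lower: "C \<le> B" if "holds_on \<alpha> B (nonneg_seqs \<inter> nonincreasing_seqs)" for B
    using nonincreasing_constant_ge_one[OF that] nonincreasing_constant_ge[OF that, of \<alpha>]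
      nonincreasing_constant_eq_infinity[OF that]
    by (auto simp: C_def)
  note best = best_constant_between[OF upper lower]
  have 1: "best_constant \<alpha> UNIV C" by (rule best) auto
  have 2: "best_constant \<alpha> nonneg_seqs C" by (rule best) auto
  have 3: "best_constant \<alpha> (nonneg_seqs \<inter> nonincreasing_seqs) C" by (rule best) auto
  have 4: "best_constant \<alpha> (nonneg_seqs \<inter> nondecreasing_seqs) (if \<alpha> \<le> 0 then 1 else 0)"
    using averaging_ineq_one nondecreasing_constant_ge_one averaging_ineq_zero_nondecreasing
    by (auto simp: best_constant_def holds_on_def)
  show ?thesis
    using 1 2 3 4
    by (simp add: best_constant_iff_le[OF 1] best_constant_iff_le[OF 2] best_constant_iff_le[OF 3])
qed

end
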